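(* Let $S\subset\mathbb{Z}_{\ge 0}$ be a numerical semigroup and let $m_1,m_2$ be nonzero elements of $S$. Then, as rational functions in an indeterminate $q$, $$\frac{\sum_{k\in Ap_{m_1}(S)}q^k}{q^{m_1}-1}=\frac{\sum_{k\in Ap_{m_2}(S)}q^k}{q^{m_2}-1}=\sum_{k\in\mathbb{Z}_{\ge 0}\setminus S}q^k+\frac{1}{q-1}.$$ In particular, for coprime positive integers $a,b$ and the numerical semigroup $S_{a,b}$ generated by $a$ and $b$, $$Ap_{ab}(S_{a,b})=\{ia+jb:\ i=0,1,\dots,b-1;\ j=0,1,\dots,a-1\}.$$
   Context: A set $S\subset\mathbb{Z}_{\ge 0}$ is a numerical semigroup if it contains $0$, is closed under addition and has finite complement in $\mathbb{Z}_{\ge 0}$. For $m\in S$, $m\ne 0$, the Apéry set is $Ap_m(S):=\{s\in S:\ s-m\notin S\}$. For coprime positive integers $a,b$, $S_{a,b}=\{ua+vb:\ u,v\in\mathbb{Z}_{\ge 0}\}$. *)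

theory Defs
  imports "HOL-Computational_Algebra.Fraction_Field"
    "HOL-Computational_Algebra.Polynomial"
begin

definition numerical_semigroup :: "nat set \<Rightarrow> bool" where
  "numerical_semigroup S \<longleftrightarrow>
     0 \<in> S \<and> (\<forall>x\<in>S. \<forall>y\<in>S. x + y \<in> S) \<and> finite (- S)"

text \<open>The difference \<open>s - m\<close> is taken in the integers, since subtraction on the naturals truncates.\<close>

definition Apery :: "nat \<Rightarrow> nat set \<Rightarrow> nat set" where
  "Apery m S = {s \<in> S. int s - int m \<notin> int ` S}"

definition semigroup_gen2 :: "nat \<Rightarrow> nat \<Rightarrow> nat set" where
  "semigroup_gen2 a b = {u * a + v * b | u v. True}"

text \<open>The indeterminate of the field of rational functions over the rational numbers.\<close>

definition q :: "rat poly fract" where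
  "q = Fraction_Field.Fract [:0, 1:] 1"

end

theory Submission
  imports Defs "HOL-Number_Theory.Cong"
begin

text \<open>If \<open>m \<in> S\<close>, a number \<open>n\<close> lies in \<open>Ap\<^sub>m(S)\<close> or is a gap of \<open>S\<close> exactly when
  \<open>n - m\<close> is negative or a gap, so the Apery set and the gaps together partition into
  \<open>{..<m}\<close> and the gaps shifted by \<open>m\<close>; summing \<open>q\<^sup>k\<close> over both decompositions gives the first
  part. For the second part, every integer has a unique representation \<open>i a + t b\<close> with
  \<open>0 \<le> i < b\<close>, and it belongs to \<open>S\<^bsub>a,b\<^esub>\<close> if and only if \<open>t \<ge> 0\<close>; subtracting
  \<open>a b\<close> replaces \<open>t\<close> by \<open>t - a\<close>.\<close>

lemma int_diff_mem_image_int_iff: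
  "int s - int m \<in> int ` S \<longleftrightarrow> m \<le> s \<and> s - m \<in> S"
proof
  assume "int s - int m \<in> int ` S"
  then obtain t where "t \<in> S" "int s - int m = int t" by blast
  then have "s = t + m" by linarith
  with \<open>t \<in> S\<close> show "m \<le> s \<and> s - m \<in> S" by simp
next
  assume "m \<le> s \<and> s - m \<in> S"
  then show "int s - int m \<in> int ` S"
    by (metis image_eqI of_nat_diff)
qed

lemma Apery_Un_gaps:
  assumes "numerical_semigroup S" "m \<in> S"
  shows "Apery m S \<union> - S = {..<m} \<union> (+) m ` (- S)"
proof (intro set_eqI)
  fix n
  \<comment> \<open>Adding \<open>m\<close> stays inside \<open>S\<close>, so a gap \<open>n\<close>
    with \<open>m <= n\<close> has \<open>n - m\<close> as a gap too; this places all of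
    \<open>- S\<close> in the right-hand side.\<close>
  have "n \<in> S" if "m \<le> n" "n - m \<in> S"
    using assms that unfolding numerical_semigroup_def by (metis le_add_diff_inverse)
  moreover have "n \<in> (+) m ` (- S) \<longleftrightarrow> m \<le> n \<and> n - m \<notin> S"
    by (auto intro: image_eqI[where x = "n - m"])
  ultimately show "n \<in> Apery m S \<union> - S \<longleftrightarrow> n \<in> {..<m} \<union> (+) m ` (- S)"
    by (auto simp: Apery_def int_diff_mem_image_int_iff)
qed

text \<open>The identity is purely algebraic, hence stated over any field;
  \<open>x ^ m \<noteq> 1\<close> makes the denominator nonzero and also forces
  \<open>x \<noteq> 1\<close>.\<close>

lemma sum_power_Apery:
  fixes x :: "'a::field"
  assumes S: "numerical_semigroup S" and m: "m \<in> S" and x: "x ^ m \<noteq> 1"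
  shows "(\<Sum>k\<in>Apery m S. x ^ k) / (x ^ m - 1) = (\<Sum>k\<in>- S. x ^ k) + 1 / (x - 1)"
proof -
  have fin: "finite (- S)" using S by (simp add: numerical_semigroup_def)
  \<comment> \<open>Sums over infinite sets are 0 by convention, so finiteness must precede the
    splitting; it is inherited from the other side of the partition.\<close>
  have "finite (Apery m S)"
    using Apery_Un_gaps[OF S m] fin by (metis finite_Un finite_imageI finite_lessThan)
  then have "(\<Sum>k\<in>Apery m S. x ^ k) + (\<Sum>k\<in>- S. x ^ k) = (\<Sum>k\<in>Apery m S \<union> - S. x ^ k)"
    using fin by (intro sum.union_disjoint[symmetric]) (auto simp: Apery_def)
  also have "\<dots> = (\<Sum>k<m. x ^ k) + (\<Sum>k\<in>(+) m ` (- S). x ^ k)"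
    unfolding Apery_Un_gaps[OF S m] using fin by (intro sum.union_disjoint) auto
  also have "(\<Sum>k\<in>(+) m ` (- S). x ^ k) = x ^ m * (\<Sum>k\<in>- S. x ^ k)"
    by (simp add: sum.reindex power_add sum_distrib_left)
  finally have "(\<Sum>k\<in>Apery m S. x ^ k) = (x ^ m - 1) * (\<Sum>k\<in>- S. x ^ k) + (\<Sum>k<m. x ^ k)"
    by (simp add: algebra_simps)
  moreover have "x \<noteq> 1" using x by auto
  then have "(\<Sum>k<m. x ^ k) = (x ^ m - 1) / (x - 1)" by (rule geometric_sum)
  ultimately show ?thesis
    using x by (simp add: add_divide_distrib)
qed

text \<open>Writing the power as a monomial over 1 lets \<open>q ^ m\<close> be told apart from 1 by
  polynomial degree.\<close>

lemma q_power: "q ^ m = Fraction_Field.Fract (monom 1 m) 1"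
  by (induction m)
    (simp_all add: q_def One_fract_def monom_0 one_pCons monom_Suc)

lemma q_power_neq_1:
  assumes "m \<noteq> 0"
  shows "q ^ m \<noteq> 1"
proof
  assume "q ^ m = 1"
  then have "monom 1 m = (1 :: rat poly)"
    by (simp add: q_power One_fract_def eq_fract)
  then have "degree (monom (1 :: rat) m) = 0" by simp
  with assms show False by (simp add: degree_monom_eq)
qed

text \<open>By coprimality, two coefficient pairs for the same integer differ by a multiple
  \<open>w\<close> of \<open>(b, -a)\<close>. As \<open>i\<close> is the least nonnegative first
  coefficient, passing to it from \<open>u\<close> can only increase the second one.\<close>

lemma mem_semigroup_gen2_iff:
  assumes "coprime a b" "i < b"
  shows "int i * int a + t * int b \<in> int ` semigroup_gen2 a b \<longleftrightarrow> t \<ge> 0"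
proof
  assume "int i * int a + t * int b \<in> int ` semigroup_gen2 a b"
  then obtain u v where eq: "int i * int a + t * int b = int u * int a + int v * int b"
    by (auto simp: semigroup_gen2_def)
  then have "(int u - int i) * int a = (t - int v) * int b"
    by (simp add: algebra_simps)
  then have "int b dvd int u - int i"
    using assms(1) by (metis coprime_commute coprime_dvd_mult_left_iff coprime_int_iff dvd_triv_right)
  then obtain w where w: "int u - int i = int b * w" ..
  \<comment> \<open>Otherwise \<open>u <= i - b < 0\<close>, impossible for a natural
    number.\<close>
  have "w \<ge> 0"
  proof (rule ccontr)
    assume "\<not> w \<ge> 0"
    then have "int b * w \<le> int b * (-1)" by (intro mult_left_mono) auto
    with w assms(2) show False by linarith
  qed
  moreover have "t = int v + w * int a"
  proof -
    have "int b * t = int b * (int v + w * int a)"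
      using eq w by (simp add: algebra_simps eq_diff_eq)
    with assms(2) show ?thesis by simp
  qed
  ultimately show "t \<ge> 0" by simp
next
  assume "t \<ge> 0"
  then have "int i * int a + t * int b = int (i * a + nat t * b)" by simp
  then show "int i * int a + t * int b \<in> int ` semigroup_gen2 a b"
    unfolding semigroup_gen2_def by blast
qed

text \<open>With \<open>x\<close> an inverse of \<open>a\<close> modulo \<open>b\<close>, the
  witness for \<open>i\<close> is \<open>x * n mod b\<close>; \<open>t\<close> is the quotient of
  the remaining difference by \<open>b\<close> and may be negative.\<close>

lemma coprime_representation:
  assumes "coprime a b" "b > 0"
  obtains i t where "i < b" "int n = int i * int a + t * int b"
proof -
  obtain x where "[a * x = 1] (mod b)"
    using cong_solve_coprime_nat[OF assms(1)] by auto
  then have "[a * x * n = n] (mod b)"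
    using cong_scalar_right by fastforce
  then have "[(x * n mod b) * a = n] (mod b)"
    by (simp add: cong_def mod_mult_right_eq mult_ac)
  then have "int b dvd int n - int (x * n mod b) * int a"
    by (metis cong_iff_dvd_diff cong_int_iff cong_sym of_nat_mult)
  then obtain t where "int n - int (x * n mod b) * int a = int b * t" ..
  then have "int n = int (x * n mod b) * int a + t * int b" by (simp add: algebra_simps)
  with that[of "x * n mod b" t] assms(2) show ?thesis by simp
qed

lemma numerical_semigroup_gen2:
  assumes "coprime a b" "b > 0"
  shows "numerical_semigroup (semigroup_gen2 a b)"
  unfolding numerical_semigroup_def
proof (intro conjI ballI)
  show "0 \<in> semigroup_gen2 a b" by (force simp: semigroup_gen2_def)
next
  fix x y assume "x \<in> semigroup_gen2 a b" "y \<in> semigroup_gen2 a b"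
  then obtain u v u' v' where "x = u * a + v * b" "y = u' * a + v' * b"
    by (auto simp: semigroup_gen2_def)
  then have "x + y = (u + u') * a + (v + v') * b" by (simp add: algebra_simps)
  then show "x + y \<in> semigroup_gen2 a b" unfolding semigroup_gen2_def by blast
next
  \<comment> \<open>A gap has \<open>t < 0\<close> in its representation, while \<open>i < b\<close>
    bounds the other term by \<open>a * b\<close>.\<close>
  have "n < a * b" if n: "n \<notin> semigroup_gen2 a b" for n
  proof -
    obtain i t where it: "i < b" "int n = int i * int a + t * int b"
      using coprime_representation[OF assms] .
    have "t < 0"
      using mem_semigroup_gen2_iff[OF assms(1) it(1), of t] it(2) n by auto
    then have "t * int b \<le> 0" by (simp add: mult_nonpos_nonneg)
    moreover have "t * int b \<noteq> 0" using \<open>t < 0\<close> assms(2) by simp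
    moreover have "int i * int a \<le> int b * int a" using it(1) by (intro mult_right_mono) auto
    ultimately have "int n < int b * int a" using it(2) by linarith
    then show ?thesis by (metis mult.commute of_nat_less_iff of_nat_mult)
  qed
  then have "- semigroup_gen2 a b \<subseteq> {..<a * b}" by auto
  then show "finite (- semigroup_gen2 a b)" by (rule finite_subset) simp
qed

lemma Apery_semigroup_gen2:
  assumes "coprime a b" "a > 0" "b > 0"
  shows "Apery (a * b) (semigroup_gen2 a b) =
    {i * a + j * b | i j. i \<in> {0..b - 1} \<and> j \<in> {0..a - 1}}"
proof (intro set_eqI)
  fix n
  \<comment> \<open>Keeping the representation arbitrary serves both inclusions: one takes it from
    \<open>coprime_representation\<close>, the other is given \<open>t = int j\<close>.\<close>
  have mem: "n \<in> Apery (a * b) (semigroup_gen2 a b) \<longleftrightarrow> 0 \<le> t \<and> t < int a"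
    if "i < b" "int n = int i * int a + t * int b" for i t
  proof -
    have shift: "int n - int (a * b) = int i * int a + (t - int a) * int b"
      using that(2) by (simp add: algebra_simps)
    have "int n - int (a * b) \<in> int ` semigroup_gen2 a b \<longleftrightarrow> t \<ge> int a"
      unfolding shift mem_semigroup_gen2_iff[OF assms(1) that(1)] by simp
    moreover have "n \<in> semigroup_gen2 a b \<longleftrightarrow> t \<ge> 0"
      unfolding mem_semigroup_gen2_iff[OF assms(1) that(1), symmetric] that(2)[symmetric]
      by (simp add: inj_image_mem_iff)
    ultimately show ?thesis
      unfolding Apery_def by auto
  qed
  show "n \<in> Apery (a * b) (semigroup_gen2 a b) \<longleftrightarrow>
    n \<in> {i * a + j * b | i j. i \<in> {0..b - 1} \<and> j \<in> {0..a - 1}}"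
  proof
    assume n: "n \<in> Apery (a * b) (semigroup_gen2 a b)"
    obtain i t where it: "i < b" "int n = int i * int a + t * int b"
      using coprime_representation[OF assms(1,3)] .
    with n mem have t: "0 \<le> t" "t < int a" by blast+
    then have "int n = int (i * a + nat t * b)" using it(2) by simp
    then have "n = i * a + nat t * b" by linarith
    moreover have "i \<in> {0..b - 1}" "nat t \<in> {0..a - 1}" using it(1) t by auto
    ultimately show "n \<in> {i * a + j * b | i j. i \<in> {0..b - 1} \<and> j \<in> {0..a - 1}}" by blast
  next
    assume "n \<in> {i * a + j * b | i j. i \<in> {0..b - 1} \<and> j \<in> {0..a - 1}}"
    then obtain i j where "n = i * a + j * b" "i \<le> b - 1" "j \<le> a - 1" by auto
    \<comment> \<open>Positivity of \<open>a\<close> and \<open>b\<close> turns the truncated bounds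
      \<open>b - 1\<close> and \<open>a - 1\<close> into strict ones.\<close>
    with mem[of i "int j"] assms show "n \<in> Apery (a * b) (semigroup_gen2 a b)" by auto
  qed
qed

theorem mainTheorem1:
  "(\<forall>S m1 m2. numerical_semigroup S \<and> m1 \<in> S \<and> m1 \<noteq> 0 \<and> m2 \<in> S \<and> m2 \<noteq> 0 \<longrightarrow>
      (\<Sum>k\<in>Apery m1 S. q ^ k) / (q ^ m1 - 1) = (\<Sum>k\<in>Apery m2 S. q ^ k) / (q ^ m2 - 1) \<and>
      (\<Sum>k\<in>Apery m2 S. q ^ k) / (q ^ m2 - 1) = (\<Sum>k\<in>- S. q ^ k) + 1 / (q - 1)) \<and>
   (\<forall>a b. a > 0 \<and> b > 0 \<and> coprime a b \<longrightarrow>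
      numerical_semigroup (semigroup_gen2 a b) \<and>
      Apery (a * b) (semigroup_gen2 a b) = {i * a + j * b | i j. i \<in> {0..b - 1} \<and> j \<in> {0..a - 1}})"
  by (simp add: sum_power_Apery q_power_neq_1 numerical_semigroup_gen2 Apery_semigroup_gen2)

end
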